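(* A $C^\infty$ vector field $X$ on $\mathbb{R}^2$ is stationary with respect to $g^{st}$ if and only if it is divergence free, i.e. $\mathrm{div}(X)=\frac{\partial X_1}{\partial x}+\frac{\partial X_2}{\partial y}=0$, where $X=X_1\frac{\partial}{\partial x}+X_2\frac{\partial}{\partial y}$.
   Context: $g^{st}$ is the standard $2$-Riemannian metric on $\mathbb{R}^2$: for vectors $u,v,w\in T_p\mathbb{R}^2$, $g^{st}_p(u,v/w)=\langle u,v\rangle\langle w,w\rangle-\langle u,w\rangle\langle v,w\rangle$, with $\langle\cdot,\cdot\rangle$ the Euclidean inner product. For vector fields $X,Y,Z$, $g^{st}(X,Y/Z)$ is the function $p\mapsto g^{st}_p(X(p),Y(p)/Z(p))$. A $C^\infty$ vector field $X$ is stationary with respect to $g^{st}$ if $X\big(g^{st}(Y,Z/X)\big)=g^{st}([X,Y],Z/X)+g^{st}(Y,[X,Z]/X)$ for all $C^\infty$ vector fields $Y,Z$ on $\mathbb{R}^2$. *)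

theory Defs
  imports "HOL-Analysis.Analysis"
begin

text \<open>
  Every tangent space of \<open>\<real>\<^sup>2\<close> is identified with \<open>\<real>\<^sup>2\<close>, so a vector field is a map
  \<open>real^2 \<Rightarrow> real^2\<close> whose components \<open>X p $ 1\<close> and \<open>X p $ 2\<close> are the coefficients of
  \<open>\<partial>/\<partial>x\<close> and \<open>\<partial>/\<partial>y\<close>.
\<close>

type_synonym vector_field = "real^2 \<Rightarrow> real^2"

fun C_k :: "nat \<Rightarrow> ('a::real_normed_vector \<Rightarrow> 'b::real_normed_vector) \<Rightarrow> bool" where
  "C_k 0 f \<longleftrightarrow> continuous_on UNIV f"
| "C_k (Suc k) f \<longleftrightarrow> f differentiable_on UNIV \<and>
     (\<forall>v. C_k k (\<lambda>p. frechet_derivative f (at p) v))"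

definition C_infinity :: "('a::real_normed_vector \<Rightarrow> 'b::real_normed_vector) \<Rightarrow> bool" where
  "C_infinity f \<longleftrightarrow> (\<forall>k. C_k k f)"

text \<open>The function \<open>X(f)\<close>, i.e. the vector field acting as a derivation.\<close>

definition vf_apply :: "vector_field \<Rightarrow> (real^2 \<Rightarrow> real) \<Rightarrow> real^2 \<Rightarrow> real" where
  "vf_apply X f p = frechet_derivative f (at p) (X p)"

text \<open>In coordinates \<open>[X, Y]\<^sub>i = X(Y\<^sub>i) - Y(X\<^sub>i)\<close>.\<close>

definition lie_bracket :: "vector_field \<Rightarrow> vector_field \<Rightarrow> vector_field" where
  "lie_bracket X Y p =
     (\<chi> i. vf_apply X (\<lambda>q. Y q $ i) p - vf_apply Y (\<lambda>q. X q $ i) p)"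

definition partial_deriv :: "2 \<Rightarrow> (real^2 \<Rightarrow> real) \<Rightarrow> real^2 \<Rightarrow> real" where
  "partial_deriv i f p = frechet_derivative f (at p) (axis i 1)"

definition divergence :: "vector_field \<Rightarrow> real^2 \<Rightarrow> real" where
  "divergence X p = partial_deriv 1 (\<lambda>q. X q $ 1) p + partial_deriv 2 (\<lambda>q. X q $ 2) p"

text \<open>\<open>g p u v w\<close> stands for \<open>g\<^sub>p(u, v/w)\<close>; the base point does not occur on the
  right-hand side because the standard metric has constant coefficients.\<close>

type_synonym two_metric = "real^2 \<Rightarrow> real^2 \<Rightarrow> real^2 \<Rightarrow> real^2 \<Rightarrow> real"

definition g_st :: two_metric where
  "g_st p u v w = (u \<bullet> v) * (w \<bullet> w) - (u \<bullet> w) * (v \<bullet> w)"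

definition metric_on_fields ::
  "two_metric \<Rightarrow> vector_field \<Rightarrow> vector_field \<Rightarrow> vector_field \<Rightarrow> real^2 \<Rightarrow> real" where
  "metric_on_fields g X Y Z p = g p (X p) (Y p) (Z p)"

definition stationary :: "two_metric \<Rightarrow> vector_field \<Rightarrow> bool" where
  "stationary g X \<longleftrightarrow>
     (\<forall>Y Z. C_infinity Y \<longrightarrow> C_infinity Z \<longrightarrow>
       (\<forall>p. vf_apply X (metric_on_fields g Y Z X) p =
            metric_on_fields g (lie_bracket X Y) Z X p +
            metric_on_fields g Y (lie_bracket X Z) X p))"

end

theory Submission
  imports Defs
begin

text \<open>
  On \<open>\<real>\<^sup>2\<close>, \<open>g\<^sup>s\<^sup>t(u,v/w) = \<omega>(u,w) \<omega>(v,w)\<close> for the area form \<open>\<omega>\<close>, whose Lie derivative along \<open>X\<close>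
  is \<open>div(X) \<omega>\<close>. Hence the defect in the stationarity equation is \<open>2 div(X) g\<^sup>s\<^sup>t(Y,Z/X)\<close>, so \<open>X\<close> is
  stationary iff \<open>div(X)\<close> vanishes wherever \<open>X\<close> does not. If \<open>div(X)\<close> were nonzero at a zero of \<open>X\<close>,
  it would be nonzero on a neighbourhood, so \<open>X\<close>, and with it \<open>div(X)\<close>, would vanish there.
\<close>

lemma C_infinity_const: "C_infinity (\<lambda>_::'a::real_normed_vector. c)"
proof -
  have "C_k k (\<lambda>_::'a. c)" for k
    by (induction k arbitrary: c) (simp_all add: frechet_derivative_const)
  then show ?thesis
    by (simp add: C_infinity_def)
qed

lemma C_infinity_has_derivative:
  assumes "C_infinity f"
  shows "(f has_derivative frechet_derivative f (at p)) (at p)"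
proof -
  have "C_k (Suc 0) f"
    using assms by (simp only: C_infinity_def)
  then show ?thesis
    by (auto simp: differentiable_on_def frechet_derivative_works)
qed

lemma C_infinity_continuous_derivative:
  assumes "C_infinity f"
  shows "continuous_on UNIV (\<lambda>p. frechet_derivative f (at p) v)"
proof -
  have "C_k (Suc 0) f"
    using assms by (simp only: C_infinity_def)
  then show ?thesis
    by simp
qed

lemma frechet_derivative_nth:
  assumes "C_infinity X"
  shows "frechet_derivative (\<lambda>q. X q $ i) (at p) v = frechet_derivative X (at p) v $ i"
proof -
  have "((\<lambda>q. X q $ i) has_derivative (\<lambda>v. frechet_derivative X (at p) v $ i)) (at p)"
    by (rule bounded_linear.has_derivative[OF bounded_linear_vec_nth C_infinity_has_derivative[OF assms]])
  then show ?thesis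
    by (simp add: frechet_derivative_at[symmetric])
qed

lemma lie_bracket_eq:
  assumes "C_infinity X" "C_infinity Y"
  shows "lie_bracket X Y p = frechet_derivative Y (at p) (X p) - frechet_derivative X (at p) (Y p)"
  using assms by (simp add: vec_eq_iff lie_bracket_def vf_apply_def frechet_derivative_nth)

lemma divergence_eq:
  assumes "C_infinity X"
  shows "divergence X p = frechet_derivative X (at p) (axis 1 1) $ 1
    + frechet_derivative X (at p) (axis 2 1) $ 2"
  using assms by (simp add: divergence_def partial_deriv_def frechet_derivative_nth)

lemma linear_nth_real2:
  fixes D :: "real^2 \<Rightarrow> real^2"
  assumes "linear D"
  shows "D v $ i = D (axis 1 1) $ i * v $ 1 + D (axis 2 1) $ i * v $ 2"
proof -
  have "v = v $ 1 *\<^sub>R axis 1 1 + v $ 2 *\<^sub>R axis 2 1"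
    by (simp add: vec_eq_iff forall_2 axis_def)
  then have "D v = D (v $ 1 *\<^sub>R axis 1 1 + v $ 2 *\<^sub>R axis 2 1)"
    by (rule arg_cong)
  then show ?thesis
    by (simp add: linear_add[OF assms] linear_scale[OF assms])
qed

text \<open>The Binet-Cauchy identity in the plane; each factor is a 2x2 determinant, the area form
  \<open>\<omega>\<close> evaluated at a vector and \<open>w\<close>.\<close>

lemma g_st_eq_area_product:
  "g_st p u v w = (u $ 1 * w $ 2 - u $ 2 * w $ 1) * (v $ 1 * w $ 2 - v $ 2 * w $ 1)"
  by (simp add: g_st_def inner_vec_def sum_2 algebra_simps)

text \<open>With \<open>D\<close> the derivative of \<open>X\<close> at \<open>p\<close>, the
  Leibniz rule and the brackets leave \<open>\<omega>(D Y, X) + \<omega>(Y, D X)\<close> from the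
  first factor, which equals \<open>tr(D) \<omega>(Y, X)\<close>. The second factor contributes
  likewise with \<open>Z\<close>, hence the coefficient 2.\<close>

lemma vf_apply_g_st:
  assumes X: "C_infinity X" and Y: "C_infinity Y" and Z: "C_infinity Z"
  shows "vf_apply X (metric_on_fields g_st Y Z X) p =
    metric_on_fields g_st (lie_bracket X Y) Z X p +
    metric_on_fields g_st Y (lie_bracket X Z) X p +
    2 * divergence X p * metric_on_fields g_st Y Z X p"
proof -
  define D where "D = frechet_derivative X (at p)"
  define A where "A = frechet_derivative Y (at p)"
  define B where "B = frechet_derivative Z (at p)"
  have hd: "((\<lambda>q. V q $ i) has_derivative (\<lambda>v. frechet_derivative V (at p) v $ i)) (at p)"
    if "C_infinity V" for V :: vector_field and i
    by (rule bounded_linear.has_derivative[OF bounded_linear_vec_nth C_infinity_has_derivative[OF that]])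
  note hd' = hd[OF X, folded D_def] hd[OF Y, folded A_def] hd[OF Z, folded B_def]
  have met: "metric_on_fields g_st Y Z X =
    (\<lambda>q. (Y q $ 1 * X q $ 2 - Y q $ 2 * X q $ 1) * (Z q $ 1 * X q $ 2 - Z q $ 2 * X q $ 1))"
    by (simp add: fun_eq_iff metric_on_fields_def g_st_eq_area_product)
  define y1 y2 z1 z2 x1 x2 where defs:
    "y1 = Y p $ 1" "y2 = Y p $ 2" "z1 = Z p $ 1" "z2 = Z p $ 2" "x1 = X p $ 1" "x2 = X p $ 2"
  have "(metric_on_fields g_st Y Z X has_derivative
    (\<lambda>v. (y1 * x2 - y2 * x1) * (B v $ 1 * x2 + z1 * D v $ 2 - B v $ 2 * x1 - z2 * D v $ 1) +
      (A v $ 1 * x2 + y1 * D v $ 2 - A v $ 2 * x1 - y2 * D v $ 1) * (z1 * x2 - z2 * x1))) (at p)"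
    unfolding met defs
    by (rule has_derivative_eq_rhs, (rule has_derivative_mult has_derivative_diff hd')+)
      (simp add: fun_eq_iff algebra_simps)
  from frechet_derivative_at[OF this, symmetric]
  have *: "vf_apply X (metric_on_fields g_st Y Z X) p =
      (y1 * x2 - y2 * x1) *
        (B (X p) $ 1 * x2 + z1 * D (X p) $ 2 - B (X p) $ 2 * x1 - z2 * D (X p) $ 1) +
      (A (X p) $ 1 * x2 + y1 * D (X p) $ 2 - A (X p) $ 2 * x1 - y2 * D (X p) $ 1) *
        (z1 * x2 - z2 * x1)"
    by (simp add: vf_apply_def)
  have "linear D"
    unfolding D_def using C_infinity_has_derivative[OF X] has_derivative_linear by blast
  \<comment> \<open>Expanding \<open>D\<close> at \<open>X p\<close>, \<open>Y p\<close> and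
    \<open>Z p\<close> by matrix entries reduces the claim to a polynomial identity in which
    \<open>divergence X p\<close> is the trace of \<open>D\<close>.\<close>
  note D = linear_nth_real2[OF this]
  show ?thesis
    unfolding * metric_on_fields_def g_st_eq_area_product lie_bracket_eq[OF X Y] lie_bracket_eq[OF X Z]
      divergence_eq[OF X] D_def[symmetric] A_def[symmetric] B_def[symmetric] vector_minus_component
      D[of "X p"] D[of "Y p"] D[of "Z p"] defs[symmetric]
    by (simp add: algebra_simps)
qed

text \<open>The derivative depends only on the germ of \<open>X\<close> at \<open>p\<close>, here
  that of the zero field.\<close>

lemma divergence_eq_0_if_locally_0:
  assumes "C_infinity X" "open U" "p \<in> U" "\<And>q. q \<in> U \<Longrightarrow> X q = 0"
  shows "divergence X p = 0"
proof -
  have "(X has_derivative (\<lambda>_. 0)) (at p)"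
    by (rule has_derivative_transform_within_open[of "\<lambda>_. 0" _ _ UNIV U]) (use assms in auto)
  then have "frechet_derivative X (at p) = (\<lambda>_. 0)"
    by (simp add: frechet_derivative_at[symmetric])
  then show ?thesis
    by (simp add: divergence_eq[OF assms(1)])
qed

theorem corollary4p21:
  fixes X :: "real^2 \<Rightarrow> real^2"
  assumes "C_infinity X"
  shows "stationary g_st X \<longleftrightarrow> (\<forall>p. divergence X p = 0)"
proof
  assume "\<forall>p. divergence X p = 0"
  then show "stationary g_st X"
    using assms by (simp add: stationary_def vf_apply_g_st)
next
  assume stat: "stationary g_st X"
  have zero: "X p = 0" if "divergence X p \<noteq> 0" for p
  proof -
    \<comment> \<open>\<open>w\<close> is \<open>X p\<close> turned by a right angle, so
      \<open>\<omega>(w, X p)\<close> is minus the squared length of \<open>X p\<close>. The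
      constant field \<open>w\<close> serves as both test fields.\<close>
    define w :: "real^2" where "w = vector [- (X p $ 2), X p $ 1]"
    \<comment> \<open>Stationarity forces the defect
      \<open>2 * divergence X p * g_st p w w (X p)\<close> to vanish, and the divergence factor can
      be cancelled.\<close>
    have "metric_on_fields g_st (\<lambda>_. w) (\<lambda>_. w) X p = 0"
      using stat vf_apply_g_st[OF assms C_infinity_const[of w] C_infinity_const[of w], of p] that
      by (simp add: stationary_def C_infinity_const)
    moreover have "metric_on_fields g_st (\<lambda>_. w) (\<lambda>_. w) X p = ((X p $ 1)\<^sup>2 + (X p $ 2)\<^sup>2)\<^sup>2"
      by (simp add: metric_on_fields_def g_st_eq_area_product w_def power2_eq_square algebra_simps)
    ultimately show ?thesis
      by (simp add: vec_eq_iff forall_2)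
  qed
  have "continuous_on UNIV (divergence X)"
    unfolding divergence_eq[OF assms, abs_def]
    by (intro continuous_intros C_infinity_continuous_derivative assms)
  then have "open {p. divergence X p \<noteq> 0}"
    by (intro open_Collect_neq continuous_intros)
  then show "\<forall>p. divergence X p = 0"
    using divergence_eq_0_if_locally_0[OF assms] zero by blast
qed

end
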